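(* Let $G$ be a finite group with a cohomological model, i.e. a contraction with projection $F:\mathrm{Hom}(\bar B(\mathbb{Z}[G]),\mathbb{Z}_2)\to cohG$, injection $K: cohG\to \mathrm{Hom}(\bar B(\mathbb{Z}[G]),\mathbb{Z}_2)$ and homotopy $\phi$, with $cohG$ of finite type and codifferential $d$. Let $\{u_1,\dots,u_q\}$, $\mathcal{B}_i=\{e_1,\dots,e_r\}$ and $\{v_1,\dots,v_s\}$ be bases for $cohG$ at dimensions $i-1$, $i$ and $i+1$, respectively. Let $M_{i-1}(d)$ be the $q\times r$ matrix with rows $d(u_1),\dots,d(u_q)$ and $M_i(d)$ the $r\times s$ matrix with rows $d(e_1),\dots,d(e_r)$, with coefficients in $\mathbb{Z}_2$, representing the codifferentials $d^{i-1}$ and $d^i$. Let $$D_{i-1}=\begin{pmatrix} I_l&0\\0&0\end{pmatrix}_{q\times r},\qquad D_i=\begin{pmatrix} I_k&0\\0&0\end{pmatrix}_{r\times s}$$ be their binary Smith normal forms, so that $H^i(G;\mathbb{Z}_2)\cong H^i(cohG;\mathbb{Z}_2)\cong\mathbb{Z}_2^{r-k-l}$, and let $P_j,Q_j$ be change of basis matrices with $D_j=P_j\,M_j(d)\,Q_j$ for $j=i-1,i$. Proceed as follows. 1. A basis $\bar{\mathcal C}$ for $\mathrm{Im}\,d^{i-1}$ with regard to $\mathcal{B}_i$ is obtained from the first $l$ columns of $Q_{i-1}^{-1}$; thus $\bar{\mathcal C}$ is a basis for $i$-coboundaries over $cohG$. 2. A basis $\bar{\mathcal D}$ for $\mathrm{Ker}\,d^i$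 with regard to $\mathcal{B}_i$ is obtained from the last $r-k$ rows of $P_i$; thus $\bar{\mathcal D}$ is a basis for $i$-cocycles over $cohG$. 3. Select those $r-k-l$ elements in $\bar{\mathcal D}$ which are not linear combinations of the elements in $\bar{\mathcal C}$. This forms a basis $\bar{\mathcal B}$ for representative $i$-cocycles over $cohG$. 4. Lift $\bar{\mathcal B}$ to the corresponding basis $\mathcal{B}$ in the $i$-th cohomology of $\mathrm{Hom}(\bar B(\mathbb{Z}[G]),\mathbb{Z}_2)$ by means of the injection $K$. Then this scheme defines a basis $\mathcal{B}$ for representative $i$-cocycles over $G$.
   Context: $\bar B(\mathbb{Z}[G])$ is the reduced bar construction of $G$, i.e. the reduced complex associated to the standard bar resolution; $\bar B_n(\mathbb{Z}[G])$ is generated by the symbols $[g_1,\dots,g_n]$, $g_j\in G$. An $n$-cochain in $\mathrm{Hom}(\bar B(\mathbb{Z}[G]),\mathbb{Z}_2)$ is given by a function $f$ on such symbols with values in $\mathbb{Z}_2$, with codifferential $$(\delta f)([h_1,\dots,h_{n+1}])=f([h_2,\dots,h_{n+1}])+\sum_{j=1}^{n}f([h_1,\dots,h_jh_{j+1},\dots,h_{n+1}])+f([h_1,\dots,h_n]) \pmod 2,$$ and its cohomology is $H^*(G;\mathbb{Z}_2)$. Cocycles are the cochains in the kernel of the codifferential and coboundaries are those in its image. A contraction from a cochain complex $N$ to a cochain complex $M$ is a special type of homotopy equivalence: cochain maps $F:N\to M$ (projection) and $K:M\to N$ (injection) and a homotopy $\phi:N\to N$ of degree $-1$ such that $FK=1_M$,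 $1_N-KF=d_N\phi+\phi d_N$, $F\phi=0$, $\phi K=0$, $\phi\phi=0$. A cohomological model for $G$ is a contraction from $\mathrm{Hom}(\bar B(\mathbb{Z}[G]),\mathbb{Z}_2)$ to a differential graded comodule of finite type $cohG$. A basis for representative $i$-cocycles is a set of $i$-cocycles whose cohomology classes form a basis of the $i$-th cohomology with coefficients in $\mathbb{Z}_2$.
   Formalization: Step 1 uses the first l rows (not columns) of Q_{i-1}^{-1}, as the row convention for M requires; step 3 selects r-k-l elements of D-bar, none a linear combination of the elements of C-bar and the other selected ones (not of C-bar alone). As written both steps can fail. *)

theory Defs
  imports Jordan_Normal_Form.VS_Connect "HOL-Algebra.AbelCoset" "HOL-Library.Z2"
begin

section \<open>Cochain complexes over the field with two elements\<close>

text \<open>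
  \<open>bit\<close> is the field with two elements.  Complexes are graded by the integers, so that the term of
  degree \<open>i - 1\<close> makes sense for every \<open>i\<close>.
\<close>

abbreviation Z2 :: "bit ring" where
  "Z2 \<equiv> class_ring"

text \<open>These simp rules would rewrite the operations inside the ring record \<open>Z2\<close>.\<close>

declare add_bit_eq_xor [simp del] mult_bit_eq_and [simp del]

locale cochain_complex =
  fixes C :: "int \<Rightarrow> (bit, 'a) module" and d :: "int \<Rightarrow> 'a \<Rightarrow> 'a"
  assumes codiff_linear: "linear_map Z2 (C n) (C (n + 1)) (d n)"
    and codiff_codiff: "x \<in> carrier (C n) \<Longrightarrow> d (n + 1) (d n x) = \<zero>\<^bsub>C (n + 1 + 1)\<^esub>"

definition cocycles :: "(int \<Rightarrow> (bit, 'a) module) \<Rightarrow> (int \<Rightarrow> 'a \<Rightarrow> 'a) \<Rightarrow> int \<Rightarrow> 'a set" where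
  "cocycles C d n = {x \<in> carrier (C n). d n x = \<zero>\<^bsub>C (n + 1)\<^esub>}"

definition coboundaries :: "(int \<Rightarrow> (bit, 'a) module) \<Rightarrow> (int \<Rightarrow> 'a \<Rightarrow> 'a) \<Rightarrow> int \<Rightarrow> 'a set" where
  "coboundaries C d n = d (n - 1) ` carrier (C (n - 1))"

definition coh_class :: "(int \<Rightarrow> (bit, 'a) module) \<Rightarrow> (int \<Rightarrow> 'a \<Rightarrow> 'a) \<Rightarrow> int \<Rightarrow> 'a \<Rightarrow> 'a set" where
  "coh_class C d n x = coboundaries C d n +>\<^bsub>C n\<^esub> x"

text \<open>
  The quotient space of cocycles modulo coboundaries.  As for \<open>module_vec\<close>, the multiplicative
  fields of the module record carry no information.
\<close>

definition cohomology ::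
    "(int \<Rightarrow> (bit, 'a) module) \<Rightarrow> (int \<Rightarrow> 'a \<Rightarrow> 'a) \<Rightarrow> int \<Rightarrow> (bit, 'a set) module" where
  "cohomology C d n = \<lparr>
     carrier = coh_class C d n ` cocycles C d n,
     mult = undefined,
     one = undefined,
     zero = coboundaries C d n,
     add = set_add (C n),
     smult = (\<lambda>c X. \<Union>x\<in>X. coh_class C d n (c \<odot>\<^bsub>C n\<^esub> x))\<rparr>"

text \<open>
  A set of cocycles whose classes form a basis of the cohomology; distinct members have distinct
  classes.
\<close>

definition representative_basis ::
    "(int \<Rightarrow> (bit, 'a) module) \<Rightarrow> (int \<Rightarrow> 'a \<Rightarrow> 'a) \<Rightarrow> int \<Rightarrow> 'a set \<Rightarrow> bool" where
  "representative_basis C d n S \<longleftrightarrow>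
     S \<subseteq> cocycles C d n \<and> inj_on (coh_class C d n) S \<and>
     vectorspace.basis Z2 (cohomology C d n) (coh_class C d n ` S)"

definition isomorphic :: "(bit, 'a) module \<Rightarrow> (bit, 'b) module \<Rightarrow> bool" where
  "isomorphic V W \<longleftrightarrow> (\<exists>T. linear_map Z2 V W T \<and> bij_betw T (carrier V) (carrier W))"


section \<open>Contractions\<close>

locale contraction =
  N: cochain_complex N dN + M: cochain_complex M dM
  for N :: "int \<Rightarrow> (bit, 'a) module" and dN and M :: "int \<Rightarrow> (bit, 'b) module" and dM +
  fixes F :: "int \<Rightarrow> 'a \<Rightarrow> 'b" and K :: "int \<Rightarrow> 'b \<Rightarrow> 'a" and \<phi> :: "int \<Rightarrow> 'a \<Rightarrow> 'a"
  assumes F_linear: "linear_map Z2 (N n) (M n) (F n)"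
    and F_cochain: "x \<in> carrier (N n) \<Longrightarrow> F (n + 1) (dN n x) = dM n (F n x)"
    and K_linear: "linear_map Z2 (M n) (N n) (K n)"
    and K_cochain: "y \<in> carrier (M n) \<Longrightarrow> K (n + 1) (dM n y) = dN n (K n y)"
    and \<phi>_linear: "linear_map Z2 (N n) (N (n - 1)) (\<phi> n)"
    and F_K: "y \<in> carrier (M n) \<Longrightarrow> F n (K n y) = y"
    and homotopy: "x \<in> carrier (N n) \<Longrightarrow>
      x \<ominus>\<^bsub>N n\<^esub> K n (F n x) = dN (n - 1) (\<phi> n x) \<oplus>\<^bsub>N n\<^esub> \<phi> (n + 1) (dN n x)"
    and F_\<phi>: "x \<in> carrier (N n) \<Longrightarrow> F (n - 1) (\<phi> n x) = \<zero>\<^bsub>M (n - 1)\<^esub>"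
    and \<phi>_K: "y \<in> carrier (M n) \<Longrightarrow> \<phi> n (K n y) = \<zero>\<^bsub>N (n - 1)\<^esub>"
    and \<phi>_\<phi>: "x \<in> carrier (N n) \<Longrightarrow> \<phi> (n - 1) (\<phi> n x) = \<zero>\<^bsub>N (n - 1 - 1)\<^esub>"


section \<open>Bar cochains and cohomological models\<close>

text \<open>The list \<open>[g\<^sub>1, \<dots>, g\<^sub>n]\<close> stands for the bar symbol; there are none in negative degrees.\<close>

definition bar_symbols :: "('g, 'z) monoid_scheme \<Rightarrow> int \<Rightarrow> 'g list set" where
  "bar_symbols G n = {gs. int (length gs) = n \<and> set gs \<subseteq> carrier G}"

definition bar_cochains :: "('g, 'z) monoid_scheme \<Rightarrow> int \<Rightarrow> (bit, 'g list \<Rightarrow> bit) module" where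
  "bar_cochains G n = ring.func_space Z2 (bar_symbols G n)"

text \<open>
  Lists are indexed from 0, so \<open>hs ! (j - 1)\<close> and \<open>hs ! j\<close> are the entries \<open>h\<^sub>j\<close> and \<open>h\<^sub>j\<^sub>+\<^sub>1\<close>.
  In degree \<open>-1\<close> both outer terms are the same element of \<open>bit\<close>, so the map is zero there.
\<close>

definition bar_codiff ::
    "('g, 'z) monoid_scheme \<Rightarrow> int \<Rightarrow> ('g list \<Rightarrow> bit) \<Rightarrow> 'g list \<Rightarrow> bit" where
  "bar_codiff G n f = restrict
     (\<lambda>hs. f (tl hs)
        + (\<Sum>j = 1..nat n. f (take (j - 1) hs @ [hs ! (j - 1) \<otimes>\<^bsub>G\<^esub> hs ! j] @ drop (j + 1) hs))
        + f (butlast hs))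
     (bar_symbols G (n + 1))"

locale cohomological_model =
  contraction "bar_cochains G" "bar_codiff G" cohG d F K \<phi>
  for G :: "('g, 'z) monoid_scheme" and cohG :: "int \<Rightarrow> (bit, 'm) module" and d F K \<phi> +
  assumes finite_type: "vectorspace.fin_dim Z2 (cohG n)"


section \<open>Matrices and the selection of representatives\<close>

definition ordered_basis :: "(bit, 'a) module \<Rightarrow> 'a list \<Rightarrow> bool" where
  "ordered_basis V es \<longleftrightarrow> distinct es \<and> vectorspace.basis Z2 V (set es)"

definition of_coords :: "(bit, 'a) module \<Rightarrow> 'a list \<Rightarrow> bit vec \<Rightarrow> 'a" where
  "of_coords V es v = Missing_VectorSpace.module.lincomb_list V (\<lambda>b. v $ b) es"

text \<open>
  Row convention: row \<open>a\<close> of the matrix holds the coordinates of the image of the \<open>a\<close>-th basis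
  vector, so the map is \<open>v \<mapsto> v M\<close> on row vectors of coordinates.  If \<open>D = P M Q\<close> is diagonal of rank
  \<open>l\<close>, then \<open>M = P\<^sup>-\<^sup>1 D Q\<^sup>-\<^sup>1\<close>, and the image is spanned by the first \<open>l\<close> rows of \<open>Q\<^sup>-\<^sup>1\<close>; these are
  the columns of the inverse of the transpose of \<open>Q\<close>.  The first \<open>l\<close> columns of \<open>Q\<^sup>-\<^sup>1\<close> itself do not
  span it in general: take \<open>M = (1 1)\<close>, \<open>P = (1)\<close> and \<open>Q = Q\<^sup>-\<^sup>1\<close> with rows \<open>(1 1)\<close> and \<open>(0 1)\<close>.
\<close>

definition represents ::
    "'a list \<Rightarrow> (bit, 'b) module \<Rightarrow> 'b list \<Rightarrow> ('a \<Rightarrow> 'b) \<Rightarrow> bit mat \<Rightarrow> bool" where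
  "represents us W es f M \<longleftrightarrow>
     M \<in> carrier_mat (length us) (length es) \<and>
     (\<forall>a < length us. f (us ! a) = of_coords W es (row M a))"

definition binary_smith :: "nat \<Rightarrow> nat \<Rightarrow> nat \<Rightarrow> bit mat" where
  "binary_smith nr nc k = four_block_mat
     (1\<^sub>m k) (0\<^sub>m k (nc - k))
     (0\<^sub>m (nr - k) k) (0\<^sub>m (nr - k) (nc - k))"

text \<open>
  \<open>m\<close> elements of \<open>D\<close>, none of which is a linear combination of the elements of \<open>C\<close> and the other
  selected elements.  Testing each element against \<open>C\<close> alone would admit bad choices: if \<open>a\<close> and
  \<open>b\<close> are linearly independent, \<open>D = {a, b}\<close> and \<open>C = {a + b}\<close>, then \<open>a\<close> and \<open>b\<close> are both outside
  the span of \<open>C\<close>, but represent the same class.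
\<close>

definition selection :: "(bit, 'a) module \<Rightarrow> 'a set \<Rightarrow> 'a set \<Rightarrow> nat \<Rightarrow> 'a set \<Rightarrow> bool" where
  "selection V C D m S \<longleftrightarrow>
     S \<subseteq> D \<and> card S = m \<and> (\<forall>x\<in>S. x \<notin> LinearCombinations.module.span Z2 V (C \<union> (S - {x})))"

end

(*
  If T is a surjective linear map with kernel B and S completes a basis of B to a basis of the
  domain, then T maps S injectively onto a basis of the target.  The sets picked by a selection are
  exactly those that complete the given basis of coboundaries to a basis of cocycles, so the lemma
  applies to the class map Z^i(cohG) -> H^i(cohG), and also directly to the class map composed with
  the injection K, Z^i(cohG) -> H^i(G): the contraction identities make this composite surjective
  with kernel the coboundaries over cohG.

  The bases come from passing to the rows of P and of the inverse of Q: they are coordinates of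
  bases in which the codifferential maps the a-th vector to the a-th vector for a < l and to zero
  otherwise, so the image is visible and the kernel follows from rank-nullity.
*)

theory Submission
  imports Defs
begin

section \<open>Linear algebra\<close>

text \<open>The vectors that \<open>T\<close> sends into the span on the right form a submodule, and
  this submodule contains \<open>A\<close>.\<close>

lemma (in linear_map) image_span_subset:
  assumes "A \<subseteq> carrier V"
  shows "T ` V.module.span A \<subseteq> W.module.span (T ` A)"
proof -
  have TA: "T ` A \<subseteq> carrier W"
    using assms by auto
  interpret S: submodule K "W.module.span (T ` A)" W
    by (rule W.module.span_is_submodule[OF TA])
  have "submodule K {v \<in> carrier V. T v \<in> W.module.span (T ` A)} V"
    by unfold_locales auto
  then have "V.module.span A \<subseteq> {v \<in> carrier V. T v \<in> W.module.span (T ` A)}"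
    using assms W.span_mem[OF TA] by (intro V.module.span_is_subset) auto
  then show ?thesis
    by auto
qed

text \<open>Independent subsets of \<open>W\<close> stay independent in \<open>V\<close>, so their
  size is bounded by the dimension of \<open>V\<close>. Hence a maximal one exists, and it is a
  finite basis of \<open>W\<close>.\<close>

lemma (in vectorspace) subspace_fin_dim:
  assumes "subspace K W V" and "fin_dim"
  shows "vectorspace.fin_dim K (vs W)"
proof -
  interpret W: vectorspace K "vs W"
    by (rule subspace_is_vs[OF assms(1)])
  interpret sub: submodule K W V
    using assms(1) by (rule is_module)
  have bound: "finite A \<and> card A \<le> dim" if "A \<subseteq> W \<and> W.lin_indpt A" for A
    using that span_li_not_depend(2)[OF _ sub.submodule_axioms] sub.subset
      li_le_dim[OF assms(2), of A] by auto
  have "{} \<subseteq> W \<and> W.lin_indpt {}"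
    by (simp add: W.module.lin_dep_def)
  from maximal_exists[of "\<lambda>A. A \<subseteq> W \<and> W.lin_indpt A" dim, OF bound this]
  obtain A where "finite A" and "maximal A (\<lambda>A. A \<subseteq> W \<and> W.lin_indpt A)"
    by blast
  then have "W.basis A"
    by (intro W.max_li_is_basis) simp
  with \<open>finite A\<close> show ?thesis
    by (auto simp: W.fin_dim_def W.basis_def)
qed

text \<open>Span and independence of a subset of \<open>W\<close> are the same in \<open>W\<close>
  and in \<open>V\<close>, so bases of subspaces can be handled in the ambient space.\<close>

lemma (in vectorspace) basis_subspaceI:
  assumes "submodule K W V" and "lin_indpt A" and "span A = W" and "A \<subseteq> W"
  shows "vectorspace.basis K (vs W) A"
proof -
  interpret W: vectorspace K "vs W"
    using assms(1) vectorspace_axioms by (intro subspace_is_vs subspace.intro)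
  show ?thesis
    unfolding W.basis_def using assms span_li_not_depend[OF assms(4,1)] by simp
qed

lemma (in vectorspace) basis_subspaceD:
  assumes "submodule K W V" and "vectorspace.basis K (vs W) A"
  shows "lin_indpt A" and "span A = W" and "A \<subseteq> W"
proof -
  interpret W: vectorspace K "vs W"
    using assms(1) vectorspace_axioms by (intro subspace_is_vs subspace.intro)
  show "A \<subseteq> W"
    using assms(2) by (simp add: W.basis_def)
  then show "lin_indpt A" "span A = W"
    using assms(2) span_li_not_depend[OF \<open>A \<subseteq> W\<close> assms(1)] by (simp_all add: W.basis_def)
qed

text \<open>By rank-nullity, \<open>W\<close> has dimension \<open>card S\<close>. Since
  \<open>T\<close> kills \<open>C\<close>, the image of \<open>S\<close> alone spans
  \<open>W\<close>. A spanning set with at most \<open>card S\<close> elements is then a basis, and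
  it cannot have fewer elements, which forces injectivity on \<open>S\<close>.\<close>

lemma (in linear_map) image_basis_complement_ker:
  assumes "V.basis (C \<union> S)" and "finite (C \<union> S)" and "C \<inter> S = {}"
    and C: "vectorspace.basis K (V.vs {v \<in> carrier V. T v = \<zero>\<^bsub>W\<^esub>}) C"
    and surj: "T ` carrier V = carrier W"
  shows "inj_on T S" and "W.basis (T ` S)"
proof -
  let ?k = "{v \<in> carrier V. T v = \<zero>\<^bsub>W\<^esub>}"
  have fin_dim: "V.fin_dim"
    using assms(1,2) by (auto simp: V.fin_dim_def V.basis_def)
  have CS: "C \<union> S \<subseteq> carrier V"
    using assms(1) by (simp add: V.basis_def)
  have ker: "subspace K ?k V"
    using kerT_is_subspace by (simp add: ker_def)
  interpret k: vectorspace K "V.vs ?k"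
    by (rule V.subspace_is_vs[OF ker])
  have "k.dim = card C"
    using assms(2) C by (intro k.dim_basis) auto
  moreover have "V.dim = card C + card S"
    using V.dim_basis[OF assms(2,1)] assms(2,3) by (simp add: card_Un_disjoint)
  moreover have "imT = carrier W"
    by (rule surj_imp_imT_carrier[OF surj])
  ultimately have dim: "W.dim = card S"
    using rank_nullity[OF fin_dim] by (simp add: ker_def)
  have TS: "T ` S \<subseteq> carrier W"
    using CS by auto
  have TC: "T ` C \<subseteq> {\<zero>\<^bsub>W\<^esub>}"
    using C by (auto simp: k.basis_def)
  have "carrier W \<subseteq> W.module.span (T ` (C \<union> S))"
    using image_span_subset[OF CS] assms(1) surj by (simp add: V.basis_def)
  also have "\<dots> \<subseteq> W.module.span (T ` S)"
  proof (rule W.module.span_is_subset)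
    show "T ` (C \<union> S) \<subseteq> W.module.span (T ` S)"
      using TC W.span_mem[OF TS] W.span_zero[of "T ` S"] by auto
    show "submodule K (W.module.span (T ` S)) W"
      by (rule W.module.span_is_submodule[OF TS])
  qed
  finally have gen: "W.module.span (T ` S) = carrier W"
    using W.module.span_is_subset2[OF TS] by auto
  have fin: "finite S"
    using assms(2) by simp
  then show "W.basis (T ` S)"
    using gen TS dim card_image_le by (intro W.dim_gen_is_basis) auto
  have "card S \<le> card (T ` S)"
    using W.gen_ge_dim[of "T ` S"] fin gen TS dim by simp
  then show "inj_on T S"
    using fin card_image_le by (intro eq_card_imp_inj_on) (auto intro: le_antisym)
qed

section \<open>Completing an independent set\<close>

text \<open>The elements of \<open>S\<close> are added to \<open>C\<close> one at a time, each
  outside the span of what is already there. The last hypothesis passes to smaller sets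
  \<open>S\<close> because the span is monotone.\<close>

lemma (in vectorspace) lin_indpt_UnI:
  assumes "finite S" and "C \<union> S \<subseteq> carrier V" and "lin_indpt C"
    and "\<And>x. x \<in> S \<Longrightarrow> x \<notin> span (C \<union> (S - {x}))"
  shows "lin_indpt (C \<union> S)"
  using assms
proof (induction S rule: finite_induct)
  case (insert x S)
  have "lin_indpt (C \<union> S)"
  proof (rule insert.IH)
    show "y \<notin> span (C \<union> (S - {y}))" if "y \<in> S" for y
      using insert.prems(3)[of y] that span_is_monotone[of "C \<union> (S - {y})" "C \<union> (insert x S - {y})"]
      by auto
  qed (use insert.prems in auto)
  moreover have "x \<notin> span (C \<union> S)"
    using insert.prems(3)[of x] insert.hyps by simp
  moreover from this have "x \<notin> C \<union> S"
    using span_mem[of "C \<union> S" x] insert.prems(1) by auto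
  ultimately show ?case
    using lin_dep_iff_in_span[of "C \<union> S" x] insert.prems(1) by simp
qed simp

text \<open>Steinitz extension inside a finite spanning set: take \<open>S\<close> maximal among the
  subsets of \<open>D\<close> that are disjoint from \<open>C\<close> and keep the union
  independent. An element of \<open>D\<close> outside the span could be added to
  \<open>S\<close>.\<close>

lemma (in vectorspace) basis_extension_exists:
  assumes "lin_indpt C" and "C \<subseteq> carrier V"
    and "finite D" and "D \<subseteq> carrier V" and "span D = carrier V"
  obtains S where "S \<subseteq> D" and "C \<inter> S = {}" and "basis (C \<union> S)"
proof -
  let ?P = "\<lambda>S. S \<subseteq> D \<and> C \<inter> S = {} \<and> lin_indpt (C \<union> S)"
  have "?P {}"
    using assms(1) by simp
  moreover have "finite A \<and> card A \<le> card D" if "?P A" for A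
    using that assms(3) card_mono finite_subset by blast
  ultimately obtain S where "maximal S ?P"
    using maximal_exists[of ?P "card D" "{}"] by blast
  then have S: "S \<subseteq> D" "C \<inter> S = {}" "lin_indpt (C \<union> S)"
    and max: "\<And>B. S \<subseteq> B \<Longrightarrow> ?P B \<Longrightarrow> B = S"
    by (auto simp: maximal_def)
  have CS: "C \<union> S \<subseteq> carrier V"
    using S(1) assms by auto
  have "D \<subseteq> span (C \<union> S)"
  proof
    fix x assume "x \<in> D"
    show "x \<in> span (C \<union> S)"
    proof (rule ccontr)
      assume x: "x \<notin> span (C \<union> S)"
      then have "x \<notin> C \<union> S"
        using span_mem[OF CS] by auto
      then have "?P (insert x S)"
        using x S \<open>x \<in> D\<close> lin_dep_iff_in_span[OF CS S(3), of x] assms(4) by auto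
      then have "insert x S = S"
        by (intro max) auto
      with \<open>x \<notin> C \<union> S\<close> show False
        by auto
    qed
  qed
  then have "carrier V \<subseteq> span (C \<union> S)"
    using span_is_subset[OF _ span_is_submodule[OF CS]] assms(5) by blast
  then have "basis (C \<union> S)"
    using S(3) CS span_is_subset2[OF CS] by (auto simp: basis_def)
  with S that show thesis
    by blast
qed

section \<open>Construction of linear maps\<close>

text \<open>That \<open>W\<close> is a vector space is part of the conclusion: each axiom is pulled
  back along the surjection \<open>g\<close> to the same axiom in \<open>V\<close>. This is how the
  quotient \<open>cohomology\<close> becomes a vector space.\<close>

lemma linear_map_imageI:
  assumes "vectorspace K V" and surj: "g ` carrier V = carrier W"
    and add: "\<And>x y. x \<in> carrier V \<Longrightarrow> y \<in> carrier V \<Longrightarrow> g (x \<oplus>\<^bsub>V\<^esub> y) = g x \<oplus>\<^bsub>W\<^esub> g y"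
    and smult: "\<And>c x. c \<in> carrier K \<Longrightarrow> x \<in> carrier V \<Longrightarrow> g (c \<odot>\<^bsub>V\<^esub> x) = c \<odot>\<^bsub>W\<^esub> g x"
    and zero: "g \<zero>\<^bsub>V\<^esub> = \<zero>\<^bsub>W\<^esub>"
  shows "linear_map K V W g"
proof -
  interpret V: vectorspace K V
    by fact
  have ex: "\<exists>x\<in>carrier V. w = g x" if "w \<in> carrier W" for w
    using that surj by blast
  have g: "g x \<in> carrier W" if "x \<in> carrier V" for x
    using that surj by blast
  have "vectorspace K W"
  proof (rule vs_criteria)
    show "field K"
      by (rule V.field_axioms)
    show "\<zero>\<^bsub>W\<^esub> \<in> carrier W"
      using g[of "\<zero>\<^bsub>V\<^esub>"] zero by simp
    show "\<forall>v w. v \<in> carrier W \<and> w \<in> carrier W \<longrightarrow> v \<oplus>\<^bsub>W\<^esub> w \<in> carrier W"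
      by (auto dest!: ex simp: g simp flip: add)
    show "\<forall>v\<in>carrier W. \<exists>u\<in>carrier W. v \<oplus>\<^bsub>W\<^esub> u = \<zero>\<^bsub>W\<^esub>"
    proof
      fix v assume "v \<in> carrier W"
      then obtain x where x: "x \<in> carrier V" "v = g x"
        using ex by blast
      then show "\<exists>u\<in>carrier W. v \<oplus>\<^bsub>W\<^esub> u = \<zero>\<^bsub>W\<^esub>"
        using add[of x "\<ominus>\<^bsub>V\<^esub> x"] g[of "\<ominus>\<^bsub>V\<^esub> x"] zero by (auto simp: V.M.r_neg)
    qed
    show "\<forall>c v. c \<in> carrier K \<and> v \<in> carrier W \<longrightarrow> c \<odot>\<^bsub>W\<^esub> v \<in> carrier W"
      by (auto dest!: ex simp: g simp flip: smult)
    show "\<forall>v w. v \<in> carrier W \<and> w \<in> carrier W \<longrightarrow> v \<oplus>\<^bsub>W\<^esub> w = w \<oplus>\<^bsub>W\<^esub> v"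
      by (auto dest!: ex simp: V.M.a_comm simp flip: add)
    show "\<forall>v w x. v \<in> carrier W \<and> w \<in> carrier W \<and> x \<in> carrier W \<longrightarrow>
        v \<oplus>\<^bsub>W\<^esub> w \<oplus>\<^bsub>W\<^esub> x = v \<oplus>\<^bsub>W\<^esub> (w \<oplus>\<^bsub>W\<^esub> x)"
      by (auto dest!: ex simp: V.M.a_assoc simp flip: add)
    show "\<forall>v\<in>carrier W. v \<oplus>\<^bsub>W\<^esub> \<zero>\<^bsub>W\<^esub> = v"
      by (auto dest!: ex simp flip: add zero)
    show "\<forall>v\<in>carrier W. \<one>\<^bsub>K\<^esub> \<odot>\<^bsub>W\<^esub> v = v"
      by (auto dest!: ex simp flip: smult)
    show "\<forall>a b v. a \<in> carrier K \<and> b \<in> carrier K \<and> v \<in> carrier W \<longrightarrow>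
        (a \<otimes>\<^bsub>K\<^esub> b) \<odot>\<^bsub>W\<^esub> v = a \<odot>\<^bsub>W\<^esub> (b \<odot>\<^bsub>W\<^esub> v)"
      by (auto dest!: ex simp: V.smult_assoc1 simp flip: smult)
    show "\<forall>a b v. a \<in> carrier K \<and> b \<in> carrier K \<and> v \<in> carrier W \<longrightarrow>
        (a \<oplus>\<^bsub>K\<^esub> b) \<odot>\<^bsub>W\<^esub> v = a \<odot>\<^bsub>W\<^esub> v \<oplus>\<^bsub>W\<^esub> b \<odot>\<^bsub>W\<^esub> v"
      by (auto dest!: ex simp: V.smult_l_distr simp flip: smult add)
    show "\<forall>a v w. a \<in> carrier K \<and> v \<in> carrier W \<and> w \<in> carrier W \<longrightarrow>
        a \<odot>\<^bsub>W\<^esub> (v \<oplus>\<^bsub>W\<^esub> w) = a \<odot>\<^bsub>W\<^esub> v \<oplus>\<^bsub>W\<^esub> a \<odot>\<^bsub>W\<^esub> w"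
      by (auto dest!: ex simp: V.smult_r_distr simp flip: smult add)
  qed
  then show ?thesis
    using assms(1) g add smult
    by (simp add: linear_map_def mod_hom_def mod_hom_axioms_def LinearCombinations.module_hom_def vectorspace_def)
qed

lemma linear_mapI:
  assumes "vectorspace K V" and "vectorspace K W"
    and "\<And>x. x \<in> carrier V \<Longrightarrow> g x \<in> carrier W"
    and "\<And>x y. x \<in> carrier V \<Longrightarrow> y \<in> carrier V \<Longrightarrow> g (x \<oplus>\<^bsub>V\<^esub> y) = g x \<oplus>\<^bsub>W\<^esub> g y"
    and "\<And>c x. c \<in> carrier K \<Longrightarrow> x \<in> carrier V \<Longrightarrow> g (c \<odot>\<^bsub>V\<^esub> x) = c \<odot>\<^bsub>W\<^esub> g x"
  shows "linear_map K V W g"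
  using assms by (simp add: linear_map_def mod_hom_def mod_hom_axioms_def LinearCombinations.module_hom_def vectorspace_def)

lemma linear_map_comp:
  assumes "linear_map K U V f" and "linear_map K V W g"
  shows "linear_map K U W (g \<circ> f)"
proof -
  interpret f: linear_map K U V f by fact
  interpret g: linear_map K V W g by fact
  show ?thesis
    by (rule linear_mapI) (simp_all add: f.V.vectorspace_axioms g.W.vectorspace_axioms)
qed

lemma linear_map_subspace:
  assumes "linear_map K V W f" and "submodule K A V" and "submodule K B W" and "f ` A \<subseteq> B"
  shows "linear_map K (V\<lparr>carrier := A\<rparr>) (W\<lparr>carrier := B\<rparr>) f"
proof -
  interpret f: linear_map K V W f by fact
  interpret A: submodule K A V by fact
  show ?thesis
  proof (rule linear_mapI)
    show "vectorspace K (V\<lparr>carrier := A\<rparr>)" "vectorspace K (W\<lparr>carrier := B\<rparr>)"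
      using assms(2,3) f.V.vectorspace_axioms f.W.vectorspace_axioms
      by (auto intro: f.V.subspace_is_vs f.W.subspace_is_vs subspace.intro)
  qed (use assms(4) A.subset in \<open>auto simp: subset_iff\<close>)
qed

text \<open>Both \<open>U\<close> and \<open>W\<close> are quotients of \<open>V\<close> by the same
  subspace, so the two quotient maps differ by an isomorphism.\<close>

lemma linear_map_factor:
  assumes g: "linear_map K V U g" and f: "linear_map K V W f"
    and g_surj: "g ` carrier V = carrier U" and f_surj: "f ` carrier V = carrier W"
    and ker: "\<And>x. x \<in> carrier V \<Longrightarrow> g x = \<zero>\<^bsub>U\<^esub> \<longleftrightarrow> f x = \<zero>\<^bsub>W\<^esub>"
  obtains h where "linear_map K U W h" and "bij_betw h (carrier U) (carrier W)"
proof -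
  interpret g: linear_map K V U g by fact
  interpret f: linear_map K V W f by fact
  \<comment> \<open>The value is independent of the chosen preimage: by \<open>eq\<close> below,
    \<open>g\<close> and \<open>f\<close> identify the same pairs. The same equivalence gives
    injectivity.\<close>
  define h where "h u = f (inv_into (carrier V) g u)" for u
  have eq: "g x = g y \<longleftrightarrow> f x = f y" if "x \<in> carrier V" "y \<in> carrier V" for x y
    using ker[of "x \<ominus>\<^bsub>V\<^esub> y"] that by simp
  have h: "h (g x) = f x" if "x \<in> carrier V" for x
    using that inv_into_into[of "g x" g "carrier V"] f_inv_into_f[of "g x" g "carrier V"]
    by (auto simp: h_def simp flip: eq)
  have ex: "\<exists>x\<in>carrier V. u = g x" if "u \<in> carrier U" for u
    using that g_surj by blast
  have "linear_map K U W h"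
    by (rule linear_mapI[OF g.W.vectorspace_axioms f.W.vectorspace_axioms])
      (auto dest!: ex simp: h simp flip: g.T_add g.T_smult)
  moreover have "bij_betw h (carrier U) (carrier W)"
  proof (rule bij_betw_imageI)
    show "inj_on h (carrier U)"
      by (rule inj_onI) (auto dest!: ex simp: h eq)
    show "h ` carrier U = carrier W"
      using h by (simp add: image_image flip: g_surj f_surj)
  qed
  ultimately show thesis
    by (rule that)
qed

section \<open>Linear combinations of lists\<close>

context vectorspace
begin

lemma lincomb_list_in_span:
  assumes "set ws \<subseteq> carrier V" and "c \<in> {0..<length ws} \<rightarrow> carrier K"
  shows "lincomb_list c ws \<in> span (set ws)"
proof -
  have "mk_coeff ws c \<in> set ws \<rightarrow> carrier K"
    using mk_coeff_carrier[OF assms(2)] by blast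
  then show ?thesis
    unfolding lincomb_list_as_lincomb[OF assms] span_def by blast
qed

lemma lincomb_list_add:
  assumes "set ws \<subseteq> carrier V"
    and "a \<in> {0..<length ws} \<rightarrow> carrier K" and "b \<in> {0..<length ws} \<rightarrow> carrier K"
  shows "lincomb_list (\<lambda>i. a i \<oplus>\<^bsub>K\<^esub> b i) ws = lincomb_list a ws \<oplus>\<^bsub>V\<^esub> lincomb_list b ws"
  using assms
proof (induction ws arbitrary: a b)
  case (Cons v ws)
  have "lincomb_list (\<lambda>i. a (Suc i) \<oplus>\<^bsub>K\<^esub> b (Suc i)) ws =
      lincomb_list (\<lambda>i. a (Suc i)) ws \<oplus>\<^bsub>V\<^esub> lincomb_list (\<lambda>i. b (Suc i)) ws"
    using Cons.prems by (intro Cons.IH) auto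
  moreover have "lincomb_list (\<lambda>i. a (Suc i)) ws \<in> carrier V" "lincomb_list (\<lambda>i. b (Suc i)) ws \<in> carrier V"
    using Cons.prems by (auto intro!: lincomb_list_carrier)
  moreover have "a 0 \<in> carrier K" "b 0 \<in> carrier K" "v \<in> carrier V"
    using Cons.prems by auto
  ultimately show ?case
    by (simp add: o_def smult_l_distr M.a_ac)
qed simp

lemma lincomb_list_smult:
  assumes "set ws \<subseteq> carrier V"
    and "a \<in> {0..<length ws} \<rightarrow> carrier K" and "c \<in> carrier K"
  shows "lincomb_list (\<lambda>i. c \<otimes>\<^bsub>K\<^esub> a i) ws = c \<odot>\<^bsub>V\<^esub> lincomb_list a ws"
  using assms
proof (induction ws arbitrary: a)
  case (Cons v ws)
  have "lincomb_list (\<lambda>i. c \<otimes>\<^bsub>K\<^esub> a (Suc i)) ws = c \<odot>\<^bsub>V\<^esub> lincomb_list (\<lambda>i. a (Suc i)) ws"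
    using Cons.prems by (intro Cons.IH) auto
  moreover have "lincomb_list (\<lambda>i. a (Suc i)) ws \<in> carrier V"
    using Cons.prems by (auto intro!: lincomb_list_carrier)
  moreover have "a 0 \<in> carrier K" "v \<in> carrier V"
    using Cons.prems by auto
  ultimately show ?case
    using Cons.prems(3) by (simp add: o_def smult_r_distr smult_assoc1)
qed simp

lemma lincomb_list_unit:
  assumes "set ws \<subseteq> carrier V" and "i < length ws"
  shows "lincomb_list (\<lambda>j. if j = i then \<one>\<^bsub>K\<^esub> else \<zero>\<^bsub>K\<^esub>) ws = ws ! i"
  using assms
proof (induction ws arbitrary: i)
  case (Cons v ws)
  show ?case
  proof (cases i)
    case 0
    have "lincomb_list (\<lambda>j. \<zero>\<^bsub>K\<^esub>) ws = \<zero>\<^bsub>V\<^esub>"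
      using Cons.prems(1) by (intro lincomb_list_eq_0) (auto simp: subset_iff)
    with 0 Cons.prems(1) show ?thesis
      by (simp add: o_def)
  next
    case (Suc k)
    then have "lincomb_list (\<lambda>j. if j = k then \<one>\<^bsub>K\<^esub> else \<zero>\<^bsub>K\<^esub>) ws = ws ! k"
      using Cons.prems by (intro Cons.IH) auto
    with Suc Cons.prems show ?thesis
      by (auto simp: o_def subset_iff)
  qed
qed simp

end

lemma (in linear_map) lincomb_list_image:
  assumes "set ws \<subseteq> carrier V" and "c \<in> {0..<length ws} \<rightarrow> carrier K"
  shows "T (V.module.lincomb_list c ws) = W.module.lincomb_list c (map T ws)"
  using assms
proof (induction ws arbitrary: c)
  case (Cons v ws)
  have "T (V.module.lincomb_list (\<lambda>i. c (Suc i)) ws) = W.module.lincomb_list (\<lambda>i. c (Suc i)) (map T ws)"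
    using Cons.prems by (intro Cons.IH) auto
  moreover have "V.module.lincomb_list (\<lambda>i. c (Suc i)) ws \<in> carrier V"
    using Cons.prems by (auto intro!: V.module.lincomb_list_carrier)
  moreover have "c 0 \<in> carrier K" "v \<in> carrier V"
    using Cons.prems by auto
  ultimately show ?case
    by (simp add: o_def)
qed simp

section \<open>Coordinates and Smith normal forms\<close>

lemma of_coords_linear:
  assumes "vectorspace Z2 V" and "set es \<subseteq> carrier V" and "length es = n"
  shows "linear_map Z2 (module_vec TYPE(bit) n) V (of_coords V es)"
proof (rule linear_mapI)
  interpret vectorspace Z2 V
    by fact
  show "vectorspace Z2 (module_vec TYPE(bit) n)"
    by (rule vec_vs)
  show "vectorspace Z2 V"
    by fact
  show "of_coords V es x \<in> carrier V" for x
    using assms(2) by (auto simp: of_coords_def intro!: lincomb_list_carrier)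
  \<comment> \<open>Vector sums and multiples are computed entrywise only at indices below the
    dimension. This suffices, since a combination of \<open>es\<close> reads no other
    coefficients.\<close>
  have cong: "lincomb_list a es = lincomb_list b es" if "\<And>i. i < length es \<Longrightarrow> a i = b i" for a b
    using that by (auto simp: lincomb_list_def intro!: arg_cong[where f = M.sumlist])
  show "of_coords V es (x \<oplus>\<^bsub>module_vec TYPE(bit) n\<^esub> y) = of_coords V es x \<oplus>\<^bsub>V\<^esub> of_coords V es y"
    if "x \<in> carrier (module_vec TYPE(bit) n)" "y \<in> carrier (module_vec TYPE(bit) n)" for x y
    using lincomb_list_add[OF assms(2), of "($) x" "($) y"] that assms(3)
    by (simp add: of_coords_def module_vec_simps cong[of "($) (x + y)" "\<lambda>i. x $ i + y $ i"])
  show "of_coords V es (c \<odot>\<^bsub>module_vec TYPE(bit) n\<^esub> x) = c \<odot>\<^bsub>V\<^esub> of_coords V es x"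
    if "x \<in> carrier (module_vec TYPE(bit) n)" for c x
    using lincomb_list_smult[OF assms(2), of "($) x" c] that assms(3)
    by (simp add: of_coords_def module_vec_simps cong[of "($) (c \<cdot>\<^sub>v x)" "\<lambda>i. c * x $ i"])
qed

text \<open>The image of \<open>of_coords V es\<close> is a submodule, and it contains each
  \<open>es ! i\<close> as the image of a unit vector.\<close>

lemma span_eq_of_coords_image:
  assumes "vectorspace Z2 V" and "set es \<subseteq> carrier V" and "length es = n"
  shows "LinearCombinations.module.span Z2 V (set es) = of_coords V es ` carrier_vec n"
proof -
  interpret vectorspace Z2 V
    by fact
  interpret T: linear_map Z2 "module_vec TYPE(bit) n" V "of_coords V es"
    by (rule of_coords_linear[OF assms])
  have "es ! i \<in> T.im" if "i < n" for i
  proof -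
    have "of_coords V es (vec n (\<lambda>j. if j = i then 1 else 0)) =
        lincomb_list (\<lambda>j. if j = i then 1 else 0) es"
      using assms(3) unfolding of_coords_def lincomb_list_def
      by (intro arg_cong[where f = M.sumlist]) auto
    also have "\<dots> = es ! i"
      using lincomb_list_unit[OF assms(2), of i] assms(3) that by (simp cong: if_cong)
    finally show ?thesis
      by (auto simp: T.im_def module_vec_simps intro: image_eqI[OF sym])
  qed
  then have "span (set es) \<subseteq> T.im"
    using assms(3) by (intro span_is_subset T.im_is_submodule) (auto simp: in_set_conv_nth)
  moreover have "of_coords V es x \<in> span (set es)" for x
    using lincomb_list_in_span[OF assms(2)] by (auto simp: of_coords_def)
  ultimately show ?thesis
    by (auto simp: T.im_def module_vec_simps)
qed

lemma of_coords_image: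
  assumes "linear_map Z2 V' W' f" and "set us \<subseteq> carrier V'"
  shows "f (of_coords V' us w) = of_coords W' (map f us) w"
proof -
  interpret f: linear_map Z2 V' W' f
    by fact
  show ?thesis
    using f.lincomb_list_image[OF assms(2)] by (simp add: of_coords_def)
qed


text \<open>With coordinates read as row vectors, \<open>A\<^sup>T *\<^sub>v w\<close> is
  \<open>w\<close> times \<open>A\<close>. By linearity of \<open>of_coords V es\<close> the rows of
  \<open>A\<close> can be combined in coordinate space, where this is a product with the matrix
  having these rows as columns.\<close>

lemma of_coords_rows:
  assumes "vectorspace Z2 V" and "set es \<subseteq> carrier V"
    and A: "A \<in> carrier_mat m (length es)" and w: "w \<in> carrier_vec m"
  shows "of_coords V (map (\<lambda>a. of_coords V es (row A a)) [0..<m]) w = of_coords V es (A\<^sup>T *\<^sub>v w)"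
proof -
  let ?U = "module_vec TYPE(bit) (length es)"
  have lin: "linear_map Z2 ?U V (of_coords V es)"
    by (rule of_coords_linear[OF assms(1,2) refl])
  have "map (\<lambda>a. of_coords V es (row A a)) [0..<m] = map (of_coords V es) (rows A)"
    using A by (simp add: rows_def)
  moreover have "of_coords ?U (rows A) w = A\<^sup>T *\<^sub>v w"
  proof -
    have "of_coords ?U (rows A) w = mat_of_cols (length es) (rows A) *\<^sub>v vec (length (rows A)) (($) w)"
      unfolding of_coords_def using A by (intro vec_module.lincomb_list_as_mat_mult) (auto simp: rows_def)
    also have "mat_of_cols (length es) (rows A) = A\<^sup>T"
      using A by (metis carrier_matD(2) mat_of_rows_rows transpose_mat_of_rows)
    also have "vec (length (rows A)) (($) w) = w"
      using A w by auto
    finally show ?thesis .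
  qed
  moreover have "set (rows A) \<subseteq> carrier ?U"
    using A rows_carrier[of A] by (simp add: module_vec_simps)
  ultimately show ?thesis
    using of_coords_image[OF lin, of "rows A" w] by simp
qed

text \<open>The size of \<open>P'\<close> is read off from the identity matrices that the two
  products equal.\<close>

lemma inverts_mat_carrier:
  assumes "P \<in> carrier_mat n n" and "inverts_mat P P'" and "inverts_mat P' P"
  shows "P' \<in> carrier_mat n n"
  using assms
  by (auto simp: inverts_mat_def) (metis carrier_matD carrier_mat_triv index_mult_mat(2,3) index_one_mat(2,3))+

text \<open>Every coordinate vector \<open>w\<close> is \<open>P\<^sup>T\<close> applied to the
  transposed inverse of \<open>P\<close> applied to \<open>w\<close>, so the new vectors span. In
  dimension \<open>n\<close> a spanning set of at most \<open>n\<close> vectors is a basis.\<close>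

lemma ordered_basis_of_rows:
  assumes "vectorspace Z2 V" and es: "ordered_basis V es" "length es = n"
    and P: "P \<in> carrier_mat n n" "invertible_mat P"
  shows "ordered_basis V (map (\<lambda>a. of_coords V es (row P a)) [0..<n])"
proof -
  interpret vectorspace Z2 V
    by fact
  let ?es = "map (\<lambda>a. of_coords V es (row P a)) [0..<n]"
  have sub: "set es \<subseteq> carrier V" and span: "span (set es) = carrier V"
    using es(1) by (auto simp: ordered_basis_def basis_def)
  have dim: "dim = n"
    using dim_basis[of "set es"] es by (simp add: ordered_basis_def distinct_card)
  obtain P' where P': "inverts_mat P P'" "inverts_mat P' P"
    using P(2) by (auto simp: invertible_mat_def)
  then have "P' \<in> carrier_mat n n"
    by (rule inverts_mat_carrier[OF P(1)])
  have PP: "P\<^sup>T * P'\<^sup>T = 1\<^sub>m n"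
    using P' P(1) \<open>P' \<in> carrier_mat n n\<close>
    by (simp add: inverts_mat_def flip: transpose_mult)
  have sub': "set ?es \<subseteq> carrier V"
  proof -
    interpret T: linear_map Z2 "module_vec TYPE(bit) n" V "of_coords V es"
      by (rule of_coords_linear[OF assms(1) sub es(2)])
    show ?thesis
      using P(1) T.T_im by (auto simp: module_vec_simps row_def)
  qed
  have "carrier V \<subseteq> span (set ?es)"
  proof
    fix v assume "v \<in> carrier V"
    then obtain w where w: "w \<in> carrier_vec n" "v = of_coords V es w"
      using span span_eq_of_coords_image[OF assms(1) sub es(2)] by auto
    have "P\<^sup>T *\<^sub>v (P'\<^sup>T *\<^sub>v w) = w"
      using P(1) \<open>P' \<in> carrier_mat n n\<close> w(1) PP
      by (simp flip: assoc_mult_mat_vec[of "P\<^sup>T" n n "P'\<^sup>T" n])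
    then have "v = of_coords V ?es (P'\<^sup>T *\<^sub>v w)"
      using of_coords_rows[OF assms(1) sub, of P n "P'\<^sup>T *\<^sub>v w"] w P(1) es(2) \<open>P' \<in> carrier_mat n n\<close>
      by simp
    then show "v \<in> span (set ?es)"
      using span_eq_of_coords_image[OF assms(1) sub', of n] \<open>P' \<in> carrier_mat n n\<close> w(1) by simp
  qed
  then have gen: "span (set ?es) = carrier V"
    using span_is_subset2[OF sub'] by blast
  have "card (set ?es) \<le> n"
    using card_length[of ?es] by simp
  then have "basis (set ?es)"
    using gen sub' dim by (intro dim_gen_is_basis) auto
  \<comment> \<open>A spanning set has at least \<open>n\<close> elements, so the list of length
    \<open>n\<close> has no repetitions.\<close>
  moreover have "card (set ?es) = length ?es"
    using \<open>card (set ?es) \<le> n\<close> gen_ge_dim[OF _ sub' gen] dim by simp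
  ultimately show ?thesis
    by (auto simp: ordered_basis_def card_distinct)
qed

section \<open>Bases of image and kernel from a Smith normal form\<close>

text \<open>The left side is the row vector \<open>row P a\<close> times \<open>M\<close>, written
  with a matrix acting on the left.\<close>

lemma mat_mult_transpose_row:
  fixes M :: "'a :: comm_semiring_0 mat"
  assumes "P \<in> carrier_mat m n" and "M \<in> carrier_mat n k" and "a < m"
  shows "M\<^sup>T *\<^sub>v row P a = row (P * M) a"
proof (rule eq_vecI)
  show "(M\<^sup>T *\<^sub>v row P a) $ j = row (P * M) a $ j" if "j < dim_vec (row (P * M) a)" for j
    using that assms comm_scalar_prod[of "col M j" n "row P a"] by simp
qed (use assms in simp)

lemma row_binary_smith_mult:
  assumes "R \<in> carrier_mat nc nc" and "l \<le> nr" and "l \<le> nc" and "a < nr"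
  shows "row (binary_smith nr nc l * R) a = (if a < l then row R a else 0\<^sub>v nc)"
proof (rule eq_vecI)
  have D: "binary_smith nr nc l \<in> carrier_mat nr nc"
    using assms(2,3) by (auto simp: binary_smith_def)
  show "row (binary_smith nr nc l * R) a $ j = (if a < l then row R a else 0\<^sub>v nc) $ j"
    if "j < dim_vec (if a < l then row R a else 0\<^sub>v nc)" for j
  proof -
    have j: "j < nc"
      using that assms(1) by (auto split: if_splits)
    have entry: "binary_smith nr nc l $$ (a, b) = (if a = b \<and> a < l then 1 else 0)" if "b < nc" for b
      using that assms(2-4) by (auto simp: binary_smith_def)
    have "row (binary_smith nr nc l * R) a $ j = (\<Sum>b = 0..<nc. binary_smith nr nc l $$ (a, b) * R $$ (b, j))"
      using assms(1,4) D j by (simp add: scalar_prod_def)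
    also have "\<dots> = (\<Sum>b = 0..<nc. if b = a then (if a < l then R $$ (a, j) else 0) else 0)"
      by (rule sum.cong) (auto simp: entry)
    also have "\<dots> = (if a < l then R $$ (a, j) else 0)"
      using assms(3) by (simp add: sum.delta)
    finally show ?thesis
      using assms(1,3) j by simp
  qed
  show "dim_vec (row (binary_smith nr nc l * R) a) = dim_vec (if a < l then row R a else 0\<^sub>v nc)"
    using assms(1) D by simp
qed

text \<open>From \<open>P * M * Q = D\<close> and \<open>R\<close> inverse to \<open>Q\<close>
  follows \<open>P * M = D * R\<close>. Row \<open>a\<close> of \<open>P * M\<close> holds the
  coordinates of the image of the vector given by row \<open>a\<close> of \<open>P\<close>, and
  multiplication by \<open>D\<close> keeps the first \<open>l\<close> rows of \<open>R\<close> and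
  clears the others.\<close>

lemma represents_smith:
  assumes f: "linear_map Z2 V W f" and us: "set us \<subseteq> carrier V" "length us = q"
    and es: "set es \<subseteq> carrier W" "length es = r"
    and M: "represents us W es f M"
    and P: "P \<in> carrier_mat q q" and Q: "Q \<in> carrier_mat r r"
    and R: "R \<in> carrier_mat r r" "inverts_mat Q R"
    and D: "l \<le> q" "l \<le> r" "binary_smith q r l = P * M * Q"
    and a: "a < q"
  shows "f (of_coords V us (row P a)) = (if a < l then of_coords W es (row R a) else \<zero>\<^bsub>W\<^esub>)"
proof -
  interpret f: linear_map Z2 V W f
    by fact
  have M': "M \<in> carrier_mat q r" and f_us: "\<And>b. b < q \<Longrightarrow> f (us ! b) = of_coords W es (row M b)"
    using M us(2) es(2) by (auto simp: represents_def)
  have PM: "P * M \<in> carrier_mat q r"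
    using P M' by simp
  \<comment> \<open>Inserting \<open>Q * R = 1\<close> makes the Smith form appear on the left of
    \<open>R\<close>.\<close>
  have "P * M = P * M * (Q * R)"
    using right_mult_one_mat[OF PM] Q R by (simp add: inverts_mat_def)
  also have "\<dots> = binary_smith q r l * R"
    using PM Q R(1) D(3) by simp
  finally have rows: "row (P * M) a = (if a < l then row R a else 0\<^sub>v r)"
    using row_binary_smith_mult[OF R(1) D(1,2) a] by simp
  have "f (of_coords V us (row P a)) = of_coords W (map f us) (row P a)"
    by (rule of_coords_image[OF f us(1)])
  also have "map f us = map (\<lambda>b. of_coords W es (row M b)) [0..<q]"
    using us(2) f_us by (auto intro: nth_equalityI)
  also have "of_coords W \<dots> (row P a) = of_coords W es (M\<^sup>T *\<^sub>v row P a)"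
    using M' P es a by (intro of_coords_rows f.W.vectorspace_axioms) auto
  also have "\<dots> = of_coords W es (if a < l then row R a else 0\<^sub>v r)"
    using mat_mult_transpose_row[OF P M' a] rows by simp
  finally have "f (of_coords V us (row P a)) = of_coords W es (if a < l then row R a else 0\<^sub>v r)" .
  moreover have "of_coords W es (0\<^sub>v r) = \<zero>\<^bsub>W\<^esub>"
    using linear_map.T0_is_0[OF of_coords_linear[OF f.W.vectorspace_axioms es]]
    by (simp add: module_vec_simps)
  ultimately show ?thesis
    by simp
qed

text \<open>\<open>C\<close> and \<open>B\<close> are parts of the new bases \<open>es'\<close> and
  \<open>us'\<close>, hence independent. \<open>C\<close> spans the image because \<open>f\<close>
  sends each \<open>us' ! a\<close> to \<open>es' ! a\<close> or to zero. \<open>B\<close> lies in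
  the kernel and has \<open>q - l\<close> elements, the dimension left by rank-nullity. The
  coboundaries come from the first half, for the codifferential into degree \<open>i\<close>, and
  the cocycles from the second half, for the one out of it.\<close>

lemma smith_bases:
  assumes f: "linear_map Z2 V W f" and us: "ordered_basis V us" "length us = q"
    and es: "ordered_basis W es" "length es = r"
    and M: "represents us W es f M"
    and P: "P \<in> carrier_mat q q" "invertible_mat P" and Q: "Q \<in> carrier_mat r r"
    and R: "R \<in> carrier_mat r r" "inverts_mat Q R" "inverts_mat R Q"
    and D: "l \<le> q" "l \<le> r" "binary_smith q r l = P * M * Q"
  defines "C \<equiv> {of_coords W es (row R a) | a. a < l}"
    and "B \<equiv> {of_coords V us (row P a) | a. l \<le> a \<and> a < q}"
  shows "card C = l" and "vectorspace.basis Z2 (W\<lparr>carrier := f ` carrier V\<rparr>) C"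
    and "card B = q - l"
    and "vectorspace.basis Z2 (V\<lparr>carrier := {v \<in> carrier V. f v = \<zero>\<^bsub>W\<^esub>}\<rparr>) B"
proof -
  interpret f: linear_map Z2 V W f
    by fact
  define us' where "us' = map (\<lambda>a. of_coords V us (row P a)) [0..<q]"
  define es' where "es' = map (\<lambda>a. of_coords W es (row R a)) [0..<r]"
  have "invertible_mat R"
    using R Q by (auto simp: invertible_mat_def)
  then have es': "distinct es'" "f.W.basis (set es')" "length es' = r"
    using ordered_basis_of_rows[OF f.W.vectorspace_axioms es R(1)] by (simp_all add: es'_def ordered_basis_def)
  have us': "distinct us'" "f.V.basis (set us')" "length us' = q"
    using ordered_basis_of_rows[OF f.V.vectorspace_axioms us P] by (simp_all add: us'_def ordered_basis_def)
  have us_V: "set us \<subseteq> carrier V" and es_W: "set es \<subseteq> carrier W"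
    using us(1) es(1) by (simp_all add: ordered_basis_def f.V.basis_def f.W.basis_def)
  have us'_V: "set us' \<subseteq> carrier V" and es'_W: "set es' \<subseteq> carrier W"
    using us'(2) es'(2) by (simp_all add: f.V.basis_def f.W.basis_def)
  have f_us': "f (us' ! a) = (if a < l then es' ! a else \<zero>\<^bsub>W\<^esub>)" if "a < q" for a
    using represents_smith[OF f us_V us(2) es_W es(2) M P(1) Q R(1,2) D that] that D(2)
    by (simp add: us'_def es'_def)
  have C: "C = (!) es' ` {..<l}"
    using D(2) by (auto simp: C_def es'_def)
  have B: "B = (!) us' ` {l..<q}"
    by (auto simp: B_def us'_def)
  have C_es': "C \<subseteq> set es'" and B_us': "B \<subseteq> set us'"
    using es'(3) us'(3) D(2) by (auto simp: C B)
  show card_C: "card C = l"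
    using es'(1,3) D(2) by (subst C, subst card_image) (auto intro: inj_on_nth)
  show card_B: "card B = q - l"
    using us'(1,3) by (subst B, subst card_image) (auto intro: inj_on_nth)
  have C_im: "C \<subseteq> f ` carrier V"
  proof
    fix x assume "x \<in> C"
    then obtain a where a: "a < l" "x = es' ! a"
      by (auto simp: C)
    then have "x = f (us' ! a)" "us' ! a \<in> carrier V"
      using f_us'[of a] D(1) us'(3) us'_V by auto
    then show "x \<in> f ` carrier V"
      by blast
  qed
  have C_W: "C \<subseteq> carrier W"
    using C_es' es'_W by blast
  have im: "submodule Z2 (f ` carrier V) W"
    using f.im_is_submodule by (simp add: f.im_def)
  have "f ` set us' \<subseteq> f.W.module.span C"
  proof
    fix y assume "y \<in> f ` set us'"
    then obtain a where "a < q" "y = f (us' ! a)"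
      using us'(3) by (auto simp: in_set_conv_nth)
    then show "y \<in> f.W.module.span C"
      using f_us'[of a] f.W.span_mem[OF C_W, of "es' ! a"] f.W.span_zero[of C] by (auto simp: C)
  qed
  then have "f.W.module.span (f ` set us') \<subseteq> f.W.module.span C"
    by (intro f.W.module.span_is_subset f.W.module.span_is_submodule C_W)
  then have "f ` carrier V \<subseteq> f.W.module.span C"
    using f.image_span_subset[OF us'_V] us'(2) by (auto simp: f.V.basis_def)
  then have "f.W.module.span C = f ` carrier V"
    using f.W.module.span_is_subset[OF C_im im] by blast
  moreover have "f.W.module.lin_indpt C"
    using es'(2) f.W.module.subset_li_is_li[OF _ C_es'] by (simp add: f.W.basis_def)
  ultimately show basis_C: "vectorspace.basis Z2 (W\<lparr>carrier := f ` carrier V\<rparr>) C"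
    by (intro f.W.basis_subspaceI im C_im)

  let ?k = "{v \<in> carrier V. f v = \<zero>\<^bsub>W\<^esub>}"
  have ker: "subspace Z2 ?k V"
    using f.kerT_is_subspace by (simp add: f.ker_def)
  interpret k: vectorspace Z2 "f.V.vs ?k"
    by (rule f.V.subspace_is_vs[OF ker])
  interpret i: vectorspace Z2 "f.W.vs (f ` carrier V)"
    using im f.W.vectorspace_axioms by (intro f.W.subspace_is_vs subspace.intro)
  have fin: "f.V.fin_dim"
    using us'(2) by (auto simp: f.V.fin_dim_def f.V.basis_def)
  have "i.dim = l"
    using i.dim_basis[OF _ basis_C] card_C by (simp add: C)
  moreover have "f.V.dim = q"
    using f.V.dim_basis[OF _ us'(2)] us'(1,3) by (simp add: distinct_card)
  ultimately have "k.dim = q - l"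
    using f.rank_nullity[OF fin] by (simp add: f.ker_def f.im_def)
  moreover have B_k: "B \<subseteq> ?k"
    using f_us' B_us' us'_V by (auto simp: B)
  moreover have "k.lin_indpt B"
  proof -
    have "f.V.module.lin_indpt B"
      using us'(2) f.V.module.subset_li_is_li[OF _ B_us'] by (simp add: f.V.basis_def)
    then show ?thesis
      using f.V.module.span_li_not_depend(2)[OF B_k f.V.is_module[OF ker]] by simp
  qed
  ultimately show "k.basis B"
    using f.V.subspace_fin_dim[OF ker fin] card_B by (intro k.dim_li_is_basis) (auto simp: B)
qed

section \<open>Isomorphism with a coordinate space\<close>

lemma isomorphic_sym:
  assumes "isomorphic V W"
  shows "isomorphic W V"
proof -
  obtain T where T: "linear_map Z2 V W T" "bij_betw T (carrier V) (carrier W)"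
    using assms by (auto simp: isomorphic_def)
  then interpret linear_map Z2 V W T
    by simp
  let ?S = "inv_into (carrier V) T"
  have "bij_betw ?S (carrier W) (carrier V)"
    by (rule bij_betw_inv_into[OF T(2)])
  moreover have ex: "\<exists>x\<in>carrier V. w = T x" if "w \<in> carrier W" for w
    using that T(2) by (auto simp: bij_betw_def)
  have S: "?S (T x) = x" if "x \<in> carrier V" for x
    using that T(2) by (simp add: bij_betw_def)
  have "linear_map Z2 W V ?S"
    by (rule linear_mapI[OF W.vectorspace_axioms V.vectorspace_axioms])
      (auto dest!: ex simp: S simp flip: T_add T_smult)
  ultimately show ?thesis
    by (auto simp: isomorphic_def)
qed

text \<open>The coordinate map along a basis is a surjection between spaces of equal dimension, so
  rank-nullity leaves a kernel of dimension zero.\<close>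

lemma isomorphic_module_vec:
  assumes "vectorspace Z2 V" and "vectorspace.basis Z2 V S" and "finite S"
  shows "isomorphic V (module_vec TYPE(bit) (card S))"
proof (rule isomorphic_sym)
  obtain es where es: "set es = S" "distinct es"
    using finite_distinct_list[OF assms(3)] by blast
  then have len: "length es = card S"
    using distinct_card by fastforce
  let ?U = "module_vec TYPE(bit) (card S)"
  have sub: "set es \<subseteq> carrier V" and span: "LinearCombinations.module.span Z2 V (set es) = carrier V"
    using assms es by (simp_all add: vectorspace.basis_def)
  interpret T: linear_map Z2 ?U V "of_coords V es"
    by (rule of_coords_linear[OF assms(1) sub len])
  have surj: "of_coords V es ` carrier ?U = carrier V"
    using span_eq_of_coords_image[OF assms(1) sub len] span by (simp add: module_vec_simps)
  interpret k: vectorspace Z2 "T.V.vs T.kerT"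
    by (rule T.V.subspace_is_vs[OF T.kerT_is_subspace])
  have fin: "T.V.fin_dim"
    by (rule vec_space.fin_dim)
  have "T.V.dim = card S"
    by (rule vec_space.dim_is_n)
  moreover have "T.W.dim = card S"
    by (rule T.W.dim_basis) fact+
  ultimately have "k.dim = 0"
    using T.rank_nullity[OF fin] T.surj_imp_imT_carrier[OF surj] by simp
  moreover obtain \<beta> where "finite \<beta>" "k.basis \<beta>"
    using k.finite_basis_exists T.V.subspace_fin_dim[OF T.kerT_is_subspace fin] by blast
  \<comment> \<open>The finite basis of the kernel has no elements, so the kernel is the span of the
    empty set.\<close>
  ultimately have "k.basis {}"
    using k.dim_basis[of \<beta>] by simp
  then have "carrier (T.V.vs T.kerT) = {\<zero>\<^bsub>?U\<^esub>}"
    using k.span_empty by (simp add: k.basis_def)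
  then have "inj_on (of_coords V es) (carrier ?U)"
    by (rule T.Ke0_imp_inj)
  then show "isomorphic ?U V"
    using surj T.linear_map_axioms by (auto simp: isomorphic_def bij_betw_def)
qed

section \<open>Selections as completions of a basis\<close>

text \<open>A selection is independent together with \<open>C\<close> by
  \<open>lin_indpt_UnI\<close>, and the required number of elements makes the union as large as the
  dimension of \<open>Z\<close>. Conversely, the dimension determines the number of elements, and
  independence of the union keeps each element outside the span of the others.\<close>

lemma selection_iff:
  assumes "vectorspace Z2 V" and Z: "submodule Z2 Z V"
    and D: "vectorspace.basis Z2 (V\<lparr>carrier := Z\<rparr>) D" and "finite D"
    and "C \<subseteq> Z" and "finite C" and "LinearCombinations.module.lin_indpt Z2 V C"
  shows "selection V C D (card D - card C) S \<longleftrightarrow>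
    S \<subseteq> D \<and> C \<inter> S = {} \<and> vectorspace.basis Z2 (V\<lparr>carrier := Z\<rparr>) (C \<union> S)"
proof -
  interpret vectorspace Z2 V
    by fact
  interpret sub: submodule Z2 Z V
    by fact
  interpret Z: vectorspace Z2 "vs Z"
    using Z vectorspace_axioms by (intro subspace_is_vs subspace.intro)
  note D' = basis_subspaceD[OF Z D]
  have fin: "Z.fin_dim"
    using \<open>finite D\<close> D by (auto simp: Z.fin_dim_def Z.basis_def)
  have dim: "Z.dim = card D"
    by (rule Z.dim_basis) fact+
  show ?thesis
  proof
    assume sel: "selection V C D (card D - card C) S"
    then have S: "S \<subseteq> D" "card S = card D - card C"
      and indep: "\<And>x. x \<in> S \<Longrightarrow> x \<notin> span (C \<union> (S - {x}))"
      by (auto simp: selection_def)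
    have "finite S"
      using S(1) \<open>finite D\<close> finite_subset by blast
    have CS: "C \<union> S \<subseteq> Z"
      using S(1) D'(3) \<open>C \<subseteq> Z\<close> by auto
    then have li: "lin_indpt (C \<union> S)"
      using indep \<open>finite S\<close> sub.subset assms(7) by (intro lin_indpt_UnI) auto
    \<comment> \<open>An \<open>x\<close> in both sets would belong to \<open>C\<close>, hence to
      the span that it has to avoid.\<close>
    have disj: "C \<inter> S = {}"
      using indep span_mem[of "C \<union> (S - {_})"] CS sub.subset by blast
    \<comment> \<open>Independence bounds \<open>card C\<close> by \<open>card D\<close>, so that
      the subtraction of natural numbers is not truncated.\<close>
    have "Z.lin_indpt C"
      using span_li_not_depend(2)[OF \<open>C \<subseteq> Z\<close> Z] assms(7) by simp
    then have "card C \<le> card D"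
      using Z.li_le_dim(2)[OF fin] \<open>C \<subseteq> Z\<close> dim by simp
    then have "card (C \<union> S) = card D"
      using S(2) disj \<open>finite C\<close> \<open>finite S\<close> by (simp add: card_Un_disjoint)
    then have "Z.basis (C \<union> S)"
      using span_li_not_depend(2)[OF CS Z] li \<open>finite C\<close> \<open>finite S\<close> CS dim
      by (intro Z.dim_li_is_basis[OF fin]) auto
    with S disj show "S \<subseteq> D \<and> C \<inter> S = {} \<and> Z.basis (C \<union> S)"
      by simp
  next
    assume S: "S \<subseteq> D \<and> C \<inter> S = {} \<and> Z.basis (C \<union> S)"
    then have "finite S"
      using \<open>finite D\<close> finite_subset by blast
    have CS: "C \<union> S \<subseteq> carrier V" "lin_indpt (C \<union> S)"
      using basis_subspaceD[OF Z, of "C \<union> S"] S sub.subset by auto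
    have "card (C \<union> S) = card D"
      using Z.dim_basis[of "C \<union> S"] dim S \<open>finite C\<close> \<open>finite S\<close> by simp
    then have "card S = card D - card C"
      using S \<open>finite C\<close> \<open>finite S\<close> by (simp add: card_Un_disjoint)
    moreover have "x \<notin> span (C \<union> (S - {x}))" if "x \<in> S" for x
    proof -
      have "C \<union> (S - {x}) \<union> {x} = C \<union> S" "x \<notin> C \<union> (S - {x})"
        using that S by auto
      moreover have "lin_indpt (C \<union> (S - {x}))"
        by (rule subset_li_is_li[OF CS(2)]) auto
      ultimately show ?thesis
        using lin_dep_iff_in_span[of "C \<union> (S - {x})" x] CS that by (metis Un_iff subset_iff le_supE Diff_subset)
    qed
    ultimately show "selection V C D (card D - card C) S"
      using S by (simp add: selection_def)
  qed
qed

section \<open>Cohomology and contractions\<close>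

context cochain_complex
begin

lemma vectorspace_C: "vectorspace Z2 (C n)"
  using codiff_linear[of n] by (simp add: linear_map_def)

lemma cocycles_submodule: "submodule Z2 (cocycles C d n) (C n)"
proof -
  interpret linear_map Z2 "C n" "C (n + 1)" "d n"
    by (rule codiff_linear)
  show ?thesis
    using ker_is_submodule by (simp add: ker_def cocycles_def)
qed

lemma codiff_pred_linear: "linear_map Z2 (C (n - 1)) (C n) (d (n - 1))"
  using codiff_linear[of "n - 1"] by simp

lemma coboundaries_submodule: "submodule Z2 (coboundaries C d n) (C n)"
proof -
  interpret linear_map Z2 "C (n - 1)" "C n" "d (n - 1)"
    by (rule codiff_pred_linear)
  show ?thesis
    using im_is_submodule by (simp add: im_def coboundaries_def)
qed

lemma coboundaries_subset_cocycles: "coboundaries C d n \<subseteq> cocycles C d n"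
proof -
  interpret linear_map Z2 "C (n - 1)" "C n" "d (n - 1)"
    by (rule codiff_pred_linear)
  show ?thesis
    using codiff_codiff[of _ "n - 1"] by (auto simp: coboundaries_def cocycles_def)
qed

text \<open>The coboundaries form an additive subgroup, so coset arithmetic handles addition and the
  kernel. Scalar multiplication needs independence of the representative.\<close>

lemma coh_class_linear:
  "linear_map Z2 ((C n)\<lparr>carrier := cocycles C d n\<rparr>) (cohomology C d n) (coh_class C d n)"
  and coh_class_eq_zero_iff:
  "x \<in> carrier (C n) \<Longrightarrow> coh_class C d n x = \<zero>\<^bsub>cohomology C d n\<^esub> \<longleftrightarrow> x \<in> coboundaries C d n"
proof -
  let ?B = "coboundaries C d n" and ?Z = "cocycles C d n"
  interpret C: vectorspace Z2 "C n"
    by (rule vectorspace_C)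
  interpret B: submodule Z2 ?B "C n"
    by (rule coboundaries_submodule)
  interpret Z: submodule Z2 ?Z "C n"
    by (rule cocycles_submodule)
  have subgroup: "subgroup ?B (add_monoid (C n))"
  proof (rule C.M.add.subgroupI)
    show "\<ominus>\<^bsub>C n\<^esub> b \<in> ?B" if "b \<in> ?B" for b
    proof -
      have "b \<in> carrier (C n)"
        using that B.subset by blast
      \<comment> \<open>A submodule is closed under scalars, so negatives are obtained as multiples
        by minus one.\<close>
      then have "\<ominus>\<^bsub>C n\<^esub> b = (\<ominus>\<^bsub>Z2\<^esub> \<one>\<^bsub>Z2\<^esub>) \<odot>\<^bsub>C n\<^esub> b"
        by (rule C.smult_minus_1[symmetric])
      also have "\<dots> \<in> ?B"
        using that by (intro B.smult_closed) auto
      finally show ?thesis .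
    qed
    show "?B \<noteq> {}"
      using B.zero_closed by blast
  qed (use B.subset in auto)
  interpret abelian_subgroup ?B "C n"
    by (intro abelian_subgroupI3 additive_subgroupI subgroup C.M.abelian_group_axioms)
  note [simp] = coh_class_def
  \<comment> \<open>The union in the field \<open>smult\<close> of \<open>cohomology\<close> runs
    over all representatives. All of them yield the same coset, and there is at least one, namely
    \<open>x\<close>, so the union is that coset.\<close>
  have smult: "(\<Union>y\<in>?B +>\<^bsub>C n\<^esub> x. ?B +>\<^bsub>C n\<^esub> (c \<odot>\<^bsub>C n\<^esub> y)) = ?B +>\<^bsub>C n\<^esub> (c \<odot>\<^bsub>C n\<^esub> x)"
    if x: "x \<in> carrier (C n)" for c x
  proof -
    have "?B +>\<^bsub>C n\<^esub> (c \<odot>\<^bsub>C n\<^esub> y) = ?B +>\<^bsub>C n\<^esub> (c \<odot>\<^bsub>C n\<^esub> x)" if y: "y \<in> ?B +>\<^bsub>C n\<^esub> x" for y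
    proof (rule sym, rule C.M.a_repr_independence[OF _ _ subgroup])
      obtain b where b: "b \<in> ?B" "y = b \<oplus>\<^bsub>C n\<^esub> x"
        using y by (auto simp: a_r_coset_def')
      then show "c \<odot>\<^bsub>C n\<^esub> y \<in> ?B +>\<^bsub>C n\<^esub> (c \<odot>\<^bsub>C n\<^esub> x)"
        using x B.subset B.smult_closed[of c b]
        by (auto simp: C.smult_r_distr subset_iff intro!: C.M.a_rcosI)
    qed (use x in simp)
    then show ?thesis
      using a_rcos_self[OF x] by blast
  qed
  show "linear_map Z2 ((C n)\<lparr>carrier := ?Z\<rparr>) (cohomology C d n) (coh_class C d n)"
  \<comment> \<open>This rule also provides the vector space axioms for
    \<open>cohomology C d n\<close>.\<close>
  proof (rule linear_map_imageI)
    show "vectorspace Z2 ((C n)\<lparr>carrier := ?Z\<rparr>)"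
      by (intro C.subspace_is_vs subspace.intro C.vectorspace_axioms Z.submodule_axioms)
  qed (use Z.subset in \<open>auto simp: cohomology_def smult a_rcos_sum subset_iff a_subset\<close>)
  show "coh_class C d n x = \<zero>\<^bsub>cohomology C d n\<^esub> \<longleftrightarrow> x \<in> ?B" if "x \<in> carrier (C n)"
    using that C.M.a_coset_join1[OF _ _ subgroup] C.M.a_coset_join2[OF _ subgroup]
    by (auto simp: cohomology_def)
qed

lemma coh_class_surj: "coh_class C d n ` cocycles C d n = carrier (cohomology C d n)"
  by (simp add: cohomology_def)

end

text \<open>The target is left open for two uses: the class map of the complex itself, and the class
  map of a larger complex composed with the injection of a contraction.\<close>

lemma (in cochain_complex) image_basis_of_complement:
  assumes T: "linear_map Z2 ((C n)\<lparr>carrier := cocycles C d n\<rparr>) U T"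
    and surj: "T ` cocycles C d n = carrier U"
    and ker: "\<And>x. x \<in> cocycles C d n \<Longrightarrow> T x = \<zero>\<^bsub>U\<^esub> \<longleftrightarrow> x \<in> coboundaries C d n"
    and B: "vectorspace.basis Z2 ((C n)\<lparr>carrier := coboundaries C d n\<rparr>) B"
    and BS: "vectorspace.basis Z2 ((C n)\<lparr>carrier := cocycles C d n\<rparr>) (B \<union> S)"
    and "finite (B \<union> S)" and "B \<inter> S = {}"
  shows "inj_on T S" and "vectorspace.basis Z2 U (T ` S)"
proof -
  interpret T: linear_map Z2 "(C n)\<lparr>carrier := cocycles C d n\<rparr>" U T
    by fact
  have "{x \<in> cocycles C d n. T x = \<zero>\<^bsub>U\<^esub>} = coboundaries C d n"
    using ker coboundaries_subset_cocycles by blast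
  then show "inj_on T S" "T.W.basis (T ` S)"
    using T.image_basis_complement_ker[OF BS] assms by simp_all
qed

section \<open>Contractions on cohomology\<close>

context contraction
begin

lemma F_cocycles: "F n ` cocycles N dN n \<subseteq> cocycles M dM n"
proof -
  interpret F: linear_map Z2 "N n" "M n" "F n"
    by (rule F_linear)
  interpret F': linear_map Z2 "N (n + 1)" "M (n + 1)" "F (n + 1)"
    by (rule F_linear)
  show ?thesis
    by (auto simp: cocycles_def simp flip: F_cochain)
qed

lemma K_cocycles: "K n ` cocycles M dM n \<subseteq> cocycles N dN n"
proof -
  interpret K: linear_map Z2 "M n" "N n" "K n"
    by (rule K_linear)
  interpret K': linear_map Z2 "M (n + 1)" "N (n + 1)" "K (n + 1)"
    by (rule K_linear)
  show ?thesis
    by (auto simp: cocycles_def simp flip: K_cochain)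
qed

lemma F_coboundaries: "F n ` coboundaries N dN n \<subseteq> coboundaries M dM n"
proof -
  interpret F: linear_map Z2 "N (n - 1)" "M (n - 1)" "F (n - 1)"
    by (rule F_linear)
  show ?thesis
    using F_cochain[of _ "n - 1"] by (auto simp: coboundaries_def)
qed

lemma K_coboundaries: "K n ` coboundaries M dM n \<subseteq> coboundaries N dN n"
proof -
  interpret K: linear_map Z2 "M (n - 1)" "N (n - 1)" "K (n - 1)"
    by (rule K_linear)
  show ?thesis
    using K_cochain[of _ "n - 1"] by (auto simp: coboundaries_def)
qed

text \<open>On a cocycle the term \<open>\<phi> (n + 1) (dN n x)\<close> of the homotopy identity
  vanishes, and the remaining term is a coboundary.\<close>

lemma diff_K_F_coboundary:
  assumes "x \<in> cocycles N dN n"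
  shows "x \<ominus>\<^bsub>N n\<^esub> K n (F n x) \<in> coboundaries N dN n"
proof -
  interpret \<phi>: linear_map Z2 "N n" "N (n - 1)" "\<phi> n"
    by (rule \<phi>_linear)
  interpret \<phi>': linear_map Z2 "N (n + 1)" "N n" "\<phi> (n + 1)"
    using \<phi>_linear[of "n + 1"] by simp
  interpret d: linear_map Z2 "N (n - 1)" "N n" "dN (n - 1)"
    by (rule N.codiff_pred_linear)
  have "x \<in> carrier (N n)" "dN n x = \<zero>\<^bsub>N (n + 1)\<^esub>"
    using assms by (simp_all add: cocycles_def)
  then show ?thesis
    using homotopy[of x n] by (simp add: coboundaries_def)
qed

text \<open>Both \<open>K\<close> and \<open>F\<close> preserve coboundaries, and \<open>F\<close>
  recovers \<open>y\<close> from its image under \<open>K\<close>. Thus \<open>K\<close> is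
  injective on cohomology.\<close>

lemma K_coboundary_iff:
  assumes "y \<in> cocycles M dM n"
  shows "K n y \<in> coboundaries N dN n \<longleftrightarrow> y \<in> coboundaries M dM n"
  using assms F_coboundaries[of n] K_coboundaries[of n] F_K[of y n] by (force simp: cocycles_def)

text \<open>A cocycle \<open>x\<close> differs from \<open>K n (F n x)\<close> by a coboundary, and
  \<open>K\<close> carries coboundaries to coboundaries.\<close>

lemma F_coboundary_iff:
  assumes "x \<in> cocycles N dN n"
  shows "F n x \<in> coboundaries M dM n \<longleftrightarrow> x \<in> coboundaries N dN n"
proof
  assume "F n x \<in> coboundaries M dM n"
  then have KF: "K n (F n x) \<in> coboundaries N dN n"
    using K_coboundaries by blast
  interpret B: submodule Z2 "coboundaries N dN n" "N n"
    by (rule N.coboundaries_submodule)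
  interpret N: vectorspace Z2 "N n"
    by (rule N.vectorspace_C)
  have "x \<in> carrier (N n)" "K n (F n x) \<in> carrier (N n)"
    using assms KF B.subset by (auto simp: cocycles_def)
  then have "x = (x \<ominus>\<^bsub>N n\<^esub> K n (F n x)) \<oplus>\<^bsub>N n\<^esub> K n (F n x)"
    by (simp add: a_minus_def N.M.a_assoc N.M.l_neg)
  also have "\<dots> \<in> coboundaries N dN n"
    by (intro B.m_closed diff_K_F_coboundary assms KF)
  finally show "x \<in> coboundaries N dN n" .
qed (use F_coboundaries in blast)

lemma coh_class_K_linear:
  "linear_map Z2 ((M n)\<lparr>carrier := cocycles M dM n\<rparr>) (cohomology N dN n) (coh_class N dN n \<circ> K n)"
  by (rule linear_map_comp[OF linear_map_subspace N.coh_class_linear])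
    (fact K_linear M.cocycles_submodule N.cocycles_submodule K_cocycles)+

lemma coh_class_F_linear:
  "linear_map Z2 ((N n)\<lparr>carrier := cocycles N dN n\<rparr>) (cohomology M dM n) (coh_class M dM n \<circ> F n)"
  by (rule linear_map_comp[OF linear_map_subspace M.coh_class_linear])
    (fact F_linear M.cocycles_submodule N.cocycles_submodule F_cocycles)+

text \<open>The class of a cocycle \<open>x\<close> is also the class of \<open>K n (F n x)\<close>,
  and \<open>F n x\<close> is a cocycle.\<close>

lemma coh_class_K_surj: "(coh_class N dN n \<circ> K n) ` cocycles M dM n = carrier (cohomology N dN n)"
proof
  interpret c: linear_map Z2 "(N n)\<lparr>carrier := cocycles N dN n\<rparr>" "cohomology N dN n" "coh_class N dN n"
    by (rule N.coh_class_linear)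
  interpret N: vectorspace Z2 "N n"
    by (rule N.vectorspace_C)
  show "(coh_class N dN n \<circ> K n) ` cocycles M dM n \<subseteq> carrier (cohomology N dN n)"
    using K_cocycles by (auto simp flip: N.coh_class_surj)
  show "carrier (cohomology N dN n) \<subseteq> (coh_class N dN n \<circ> K n) ` cocycles M dM n"
  proof
    fix X assume "X \<in> carrier (cohomology N dN n)"
    then obtain x where x: "x \<in> cocycles N dN n" "X = coh_class N dN n x"
      by (auto simp flip: N.coh_class_surj)
    let ?y = "K n (F n x)"
    have Fx: "F n x \<in> cocycles M dM n" and y: "?y \<in> cocycles N dN n"
      using x(1) F_cocycles K_cocycles by blast+
    have diff: "x \<ominus>\<^bsub>N n\<^esub> ?y \<in> coboundaries N dN n"
      by (rule diff_K_F_coboundary[OF x(1)])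
    have carr: "x \<in> carrier (N n)" "?y \<in> carrier (N n)"
      using x(1) y by (simp_all add: cocycles_def)
    have "coh_class N dN n x = coh_class N dN n ((x \<ominus>\<^bsub>N n\<^esub> ?y) \<oplus>\<^bsub>N n\<^esub> ?y)"
      using carr by (simp add: a_minus_def N.M.a_assoc N.M.l_neg)
    \<comment> \<open>The class map is additive on cocycles only; the difference is one because it
      is a coboundary.\<close>
    also have "\<dots> = coh_class N dN n (x \<ominus>\<^bsub>N n\<^esub> ?y) \<oplus>\<^bsub>cohomology N dN n\<^esub> coh_class N dN n ?y"
      using c.T_add[of "x \<ominus>\<^bsub>N n\<^esub> ?y" ?y] diff y N.coboundaries_subset_cocycles by auto
    also have "coh_class N dN n (x \<ominus>\<^bsub>N n\<^esub> ?y) = \<zero>\<^bsub>cohomology N dN n\<^esub>"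
      using N.coh_class_eq_zero_iff[of "x \<ominus>\<^bsub>N n\<^esub> ?y" n] diff carr by simp
    finally have "X = coh_class N dN n ?y"
      using x(2) y c.T_im[of ?y] by simp
    then show "X \<in> (coh_class N dN n \<circ> K n) ` cocycles M dM n"
      using Fx by auto
  qed
qed

text \<open>A cocycle \<open>y\<close> is the image under \<open>F\<close> of the cocycle
  \<open>K n y\<close>.\<close>

lemma coh_class_F_surj: "(coh_class M dM n \<circ> F n) ` cocycles N dN n = carrier (cohomology M dM n)"
proof
  show "(coh_class M dM n \<circ> F n) ` cocycles N dN n \<subseteq> carrier (cohomology M dM n)"
    using F_cocycles by (auto simp flip: M.coh_class_surj)
  have "coh_class M dM n y = (coh_class M dM n \<circ> F n) (K n y)" "K n y \<in> cocycles N dN n"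
    if "y \<in> cocycles M dM n" for y
    using that K_cocycles F_K by (auto simp: cocycles_def)
  then show "carrier (cohomology M dM n) \<subseteq> (coh_class M dM n \<circ> F n) ` cocycles N dN n"
    unfolding M.coh_class_surj[symmetric] by blast
qed

text \<open>The class map of \<open>N\<close>, and \<open>F\<close> followed by the class map of
  \<open>M\<close>, are surjections from the cocycles of \<open>N\<close> with the same
  kernel.\<close>

lemma isomorphic_cohomology: "isomorphic (cohomology N dN n) (cohomology M dM n)"
proof -
  have "coh_class N dN n x = \<zero>\<^bsub>cohomology N dN n\<^esub> \<longleftrightarrow> (coh_class M dM n \<circ> F n) x = \<zero>\<^bsub>cohomology M dM n\<^esub>"
    if "x \<in> cocycles N dN n" for x
    using that F_cocycles[of n] F_coboundary_iff[OF that]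
      N.coh_class_eq_zero_iff[of x n] M.coh_class_eq_zero_iff[of "F n x" n]
    by (auto simp: cocycles_def)
  then show ?thesis
    using linear_map_factor[OF N.coh_class_linear[of n] coh_class_F_linear[of n]]
      N.coh_class_surj[of n] coh_class_F_surj[of n]
    by (simp add: isomorphic_def) metis
qed

lemma representative_basis_lift:
  assumes B: "vectorspace.basis Z2 ((M n)\<lparr>carrier := coboundaries M dM n\<rparr>) B"
    and BS: "vectorspace.basis Z2 ((M n)\<lparr>carrier := cocycles M dM n\<rparr>) (B \<union> S)"
    and fin: "finite (B \<union> S)" and disj: "B \<inter> S = {}"
  shows "representative_basis M dM n S" and "inj_on (K n) S"
    and "representative_basis N dN n (K n ` S)"
proof -
  interpret c: linear_map Z2 "(M n)\<lparr>carrier := cocycles M dM n\<rparr>" "cohomology M dM n" "coh_class M dM n"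
    by (rule M.coh_class_linear)
  have S: "S \<subseteq> cocycles M dM n"
    using BS by (simp add: c.V.basis_def)
  have "inj_on (coh_class M dM n) S" "c.W.basis (coh_class M dM n ` S)"
    using M.coh_class_eq_zero_iff
    by (intro M.image_basis_of_complement[OF M.coh_class_linear M.coh_class_surj _ B BS fin disj];
        simp add: cocycles_def)+
  with S show "representative_basis M dM n S"
    by (simp add: representative_basis_def)
  have ker: "(coh_class N dN n \<circ> K n) x = \<zero>\<^bsub>cohomology N dN n\<^esub> \<longleftrightarrow> x \<in> coboundaries M dM n"
    if "x \<in> cocycles M dM n" for x
    using that K_cocycles[of n] K_coboundary_iff[OF that] N.coh_class_eq_zero_iff[of "K n x" n]
    by (auto simp: cocycles_def)
  note KS = M.image_basis_of_complement[OF coh_class_K_linear coh_class_K_surj ker B BS fin disj]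
  \<comment> \<open>The composite with the class map is injective on \<open>S\<close>, hence so is
    its inner map.\<close>
  show "inj_on (K n) S"
    using KS(1) by (rule inj_on_imageI2)
  show "representative_basis N dN n (K n ` S)"
    using KS(2) inj_on_imageI[OF KS(1)] K_cocycles[of n] S
    unfolding representative_basis_def image_comp by blast
qed

end

section \<open>The scheme for representative cocycles\<close>

theorem proposition1:
  fixes G :: "('g, 'z) monoid_scheme"
    and cohG :: "int \<Rightarrow> (bit, 'm) module"
    and d :: "int \<Rightarrow> 'm \<Rightarrow> 'm"
    and F :: "int \<Rightarrow> ('g list \<Rightarrow> bit) \<Rightarrow> 'm"
    and K :: "int \<Rightarrow> 'm \<Rightarrow> ('g list \<Rightarrow> bit)"
    and \<phi> :: "int \<Rightarrow> ('g list \<Rightarrow> bit) \<Rightarrow> ('g list \<Rightarrow> bit)"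
    and i :: int
    and us es vs :: "'m list"
    and q r s l k :: nat
    and M0 M1 P0 Q0 Q0inv P1 Q1 :: "bit mat"
    and Cbar Dbar :: "'m set"
  assumes "group G" and "finite (carrier G)"
    and "cohomological_model G cohG d F K \<phi>"
    and "ordered_basis (cohG (i - 1)) us" and "length us = q"
    and "ordered_basis (cohG i) es" and "length es = r"
    and "ordered_basis (cohG (i + 1)) vs" and "length vs = s"
    and "represents us (cohG i) es (d (i - 1)) M0"
    and "represents es (cohG (i + 1)) vs (d i) M1"
    and "P0 \<in> carrier_mat q q" and "invertible_mat P0"
    and "Q0 \<in> carrier_mat r r" and "invertible_mat Q0"
    and "Q0inv \<in> carrier_mat r r" and "inverts_mat Q0 Q0inv" and "inverts_mat Q0inv Q0"
    and "P1 \<in> carrier_mat r r" and "invertible_mat P1"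
    and "Q1 \<in> carrier_mat s s" and "invertible_mat Q1"
    and "l \<le> q" and "l \<le> r" and "binary_smith q r l = P0 * M0 * Q0"
    and "k \<le> r" and "k \<le> s" and "binary_smith r s k = P1 * M1 * Q1"
    and "Cbar = {of_coords (cohG i) es (row Q0inv a) | a. a < l}"
    and "Dbar = {of_coords (cohG i) es (row P1 a) | a. k \<le> a \<and> a < r}"
  shows "k + l \<le> r
    \<and> isomorphic (cohomology (bar_cochains G) (bar_codiff G) i) (cohomology cohG d i)
    \<and> isomorphic (cohomology cohG d i) (module_vec TYPE(bit) (r - k - l))
    \<and> card Cbar = l
    \<and> vectorspace.basis Z2 ((cohG i)\<lparr>carrier := coboundaries cohG d i\<rparr>) Cbar
    \<and> card Dbar = r - k
    \<and> vectorspace.basis Z2 ((cohG i)\<lparr>carrier := cocycles cohG d i\<rparr>) Dbar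
    \<and> (\<exists>Bbar. selection (cohG i) Cbar Dbar (r - k - l) Bbar)
    \<and> (\<forall>Bbar. selection (cohG i) Cbar Dbar (r - k - l) Bbar \<longrightarrow>
          representative_basis cohG d i Bbar
        \<and> inj_on (K i) Bbar
        \<and> representative_basis (bar_cochains G) (bar_codiff G) i (K i ` Bbar))"
proof -
  interpret cohomological_model G cohG d F K \<phi>
    by fact
  let ?B = "coboundaries cohG d i" and ?Z = "cocycles cohG d i"
  interpret V: vectorspace Z2 "cohG i"
    by (rule M.vectorspace_C)
  have image: "d (i - 1) ` carrier (cohG (i - 1)) = ?B"
    by (simp add: coboundaries_def)
  have kernel: "{x \<in> carrier (cohG i). d i x = \<zero>\<^bsub>cohG (i + 1)\<^esub>} = ?Z"
    by (simp add: cocycles_def)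
  have C: "card Cbar = l" "vectorspace.basis Z2 ((cohG i)\<lparr>carrier := ?B\<rparr>) Cbar"
    unfolding assms(29) image[symmetric]
    by (rule smith_bases[OF M.codiff_pred_linear assms(4-7,10) assms(12-14,16-18) assms(23-25)])+
  \<comment> \<open>\<open>smith_bases\<close> works with a given inverse, here extracted from the
    invertibility of \<open>Q1\<close>.\<close>
  obtain Q1inv where Q1inv: "inverts_mat Q1 Q1inv" "inverts_mat Q1inv Q1"
    using assms(22) by (auto simp: invertible_mat_def)
  then have "Q1inv \<in> carrier_mat s s"
    by (rule inverts_mat_carrier[OF assms(21)])
  note smith1 = smith_bases[OF M.codiff_linear assms(6-9,11) assms(19-21) this Q1inv assms(26-28)]
  have D: "card Dbar = r - k" "vectorspace.basis Z2 ((cohG i)\<lparr>carrier := ?Z\<rparr>) Dbar"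
    unfolding assms(30) kernel[symmetric] by (rule smith1)+
  have fin: "finite Cbar" "finite Dbar"
    by (simp_all add: assms(29,30))
  interpret Z: vectorspace Z2 "V.vs ?Z"
    by (intro V.subspace_is_vs subspace.intro V.vectorspace_axioms M.cocycles_submodule)
  have Cbar_Z: "Cbar \<subseteq> ?Z" and li: "V.lin_indpt Cbar"
    using V.basis_subspaceD[OF M.coboundaries_submodule C(2)] M.coboundaries_subset_cocycles by blast+
  have li_Z: "Z.lin_indpt Cbar"
    using V.span_li_not_depend(2)[OF Cbar_Z M.cocycles_submodule] li by simp
  have gen: "Z.span Dbar = carrier (V.vs ?Z)" "Dbar \<subseteq> carrier (V.vs ?Z)"
    using D(2) by (simp_all add: Z.basis_def)
  \<comment> \<open>Coboundaries are cocycles: the independent set \<open>Cbar\<close> lies in the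
    space spanned by \<open>Dbar\<close>. So \<open>r - k - l\<close> is a genuine
    difference.\<close>
  have "l \<le> r - k"
    using Z.li_smaller_than_gen[OF fin _ gen(2) li_Z gen(1)] Cbar_Z C(1) D(1) by simp
  then have kl: "k + l \<le> r"
    using assms(26) by simp
  have sel: "selection (cohG i) Cbar Dbar (r - k - l) S \<longleftrightarrow>
      S \<subseteq> Dbar \<and> Cbar \<inter> S = {} \<and> Z.basis (Cbar \<union> S)" for S
    using selection_iff[OF V.vectorspace_axioms M.cocycles_submodule D(2) fin(2) Cbar_Z fin(1) li, of S]
    by (simp add: C(1) D(1))
  \<comment> \<open>Completing \<open>Cbar\<close> by elements of \<open>Dbar\<close> shows that a
    selection exists.\<close>
  obtain S where S: "S \<subseteq> Dbar" "Cbar \<inter> S = {}" "Z.basis (Cbar \<union> S)"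
    using Z.basis_extension_exists[OF li_Z _ fin(2) gen(2,1)] Cbar_Z by auto
  have lift: "representative_basis cohG d i Bbar \<and> inj_on (K i) Bbar \<and>
      representative_basis (bar_cochains G) (bar_codiff G) i (K i ` Bbar)"
    if "selection (cohG i) Cbar Dbar (r - k - l) Bbar" for Bbar
  proof -
    have "Bbar \<subseteq> Dbar" "Cbar \<inter> Bbar = {}" "Z.basis (Cbar \<union> Bbar)"
      using that unfolding sel by simp_all
    moreover have "finite (Cbar \<union> Bbar)"
      using fin finite_subset[OF \<open>Bbar \<subseteq> Dbar\<close>] by simp
    ultimately show ?thesis
      using representative_basis_lift[OF C(2), of Bbar] by simp
  qed
  \<comment> \<open>The dimension is read off from the selection \<open>S\<close>: its
    \<open>r - k - l\<close> elements have distinct classes, and these form a basis of the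
    cohomology.\<close>
  have "isomorphic (cohomology cohG d i) (module_vec TYPE(bit) (r - k - l))"
  proof -
    have S_sel: "selection (cohG i) Cbar Dbar (r - k - l) S"
      using S sel by simp
    have "card S = r - k - l" "finite S"
      using S_sel finite_subset[OF S(1) fin(2)] by (simp_all add: selection_def)
    moreover have "inj_on (coh_class cohG d i) S"
      and "vectorspace.basis Z2 (cohomology cohG d i) (coh_class cohG d i ` S)"
      using lift[OF S_sel] by (simp_all add: representative_basis_def)
    moreover have "vectorspace Z2 (cohomology cohG d i)"
      using M.coh_class_linear[of i] by (simp add: linear_map_def)
    ultimately show ?thesis
      using isomorphic_module_vec[of "cohomology cohG d i" "coh_class cohG d i ` S"]
      by (simp add: card_image)
  qed
  with kl C D S sel lift isomorphic_cohomology[of i] show ?thesis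
    by blast
qed

end
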